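(* Let $k$ be a field with $\operatorname{char}k\neq2$ and let $M\supseteq k$ be a Hilbertian field. For every $\mathbf a=(a,b)\in M^2$ with $D_{\mathbf a}\neq0$, there exist infinitely many $\mathbf a'=(a',b')\in M^2$ such that $b'/b$ is not a fourth power in $M$ and the splitting fields over $M$ of $X^4+aX^2+b$ and of $X^4+a'X^2+b'$ coincide.
   Context: $D_{\mathbf a}=16b(a^2-4b)^2$ is the discriminant of $X^4+aX^2+b$. *)

theory Defs
  imports
    "HOL-Computational_Algebra.Computational_Algebra"
    "HOL-Algebra.Algebraic_Closure_Type"
    "HOL-Algebra.Generated_Fields"
begin

text \<open>A polynomial in \<open>M[T,X]\<close> is represented as an element of \<open>M[T][X]\<close>: the outer variable
  is \<open>X\<close>, the inner one \<open>T\<close>. It is separable in \<open>X\<close> if it is nonzero and all its roots in an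
  algebraic closure of \<open>M(T)\<close> are simple.\<close>

definition separable_in_X :: "'a::field poly poly \<Rightarrow> bool" where
  "separable_in_X f \<longleftrightarrow> rsquarefree (map_poly (\<lambda>c. to_ac (to_fract c)) f)"

definition specialize :: "'a::field poly poly \<Rightarrow> 'a \<Rightarrow> 'a poly" where
  "specialize f t = map_poly (\<lambda>c. poly c t) f"

text \<open>A field \<open>M\<close> is Hilbertian if every irreducible \<open>f \<in> M[T,X]\<close> of positive degree in \<open>X\<close> and
  separable in \<open>X\<close> has infinitely many irreducible specializations \<open>f(t,X) \<in> M[X]\<close>. Separability
  is the usual convention in positive characteristic; it is automatic in characteristic \<open>0\<close>.
  The field is given as a type.\<close>

definition hilbertian :: "'a::field itself \<Rightarrow> bool" where
  "hilbertian _ \<longleftrightarrow>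
    (\<forall>f :: 'a poly poly. irreducible f \<longrightarrow> degree f > 0 \<longrightarrow> separable_in_X f \<longrightarrow>
      infinite {t :: 'a. irreducible (specialize f t)})"

text \<open>All splitting fields over \<open>M\<close> are taken inside one fixed algebraic closure of \<open>M\<close>, so that
  it makes sense to say that two of them coincide.\<close>

definition splitting_field :: "'a::field poly \<Rightarrow> 'a alg_closure set" where
  "splitting_field p =
    generate_field ring_of_type_algebra
      (range to_ac \<union> {x. poly (map_poly to_ac p) x = 0})"

definition biquadratic :: "'a::field \<Rightarrow> 'a \<Rightarrow> 'a poly" where
  "biquadratic a b = monom 1 4 + smult a (monom 1 2) + [:b:]"

definition biquadratic_disc :: "'a::field \<Rightarrow> 'a \<Rightarrow> 'a" where
  "biquadratic_disc a b = 16 * b * (a\<^sup>2 - 4 * b)\<^sup>2"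

end

theory Submission
  imports Defs
begin

text \<open>Let \<open>\<plusminus>\<alpha>, \<plusminus>\<beta>\<close> be the roots of \<open>X\<^sup>4 + a X\<^sup>2 + b\<close>. For \<open>t \<in> M\<close> the elements \<open>\<plusminus>\<alpha> (t + \<alpha>\<^sup>2)\<close> and
  \<open>\<plusminus>\<beta> (t + \<beta>\<^sup>2)\<close> are the roots of another biquadratic polynomial over \<open>M\<close>, which for all but finitely
  many \<open>t\<close> has the same splitting field. Its constant term is \<open>b' = b N(t)\<^sup>2\<close> with
  \<open>N(T) = T\<^sup>2 - a T + b\<close>, so \<open>b' / b\<close> is a fourth power only if \<open>N(t)\<close> or \<open>-N(t)\<close> is a square. As
  \<open>a\<^sup>2 \<noteq> 4 b\<close>, neither \<open>N\<close> nor \<open>-N\<close> is a square in \<open>M[T]\<close>, and the Hilbert property provides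
  infinitely many \<open>t\<close> for which this persists.\<close>

section \<open>Irreducibility of monic polynomials and binomials over a domain\<close>

text \<open>The leading coefficients of two factors of a monic polynomial are inverse units, so both
  factors can be rescaled to monic ones, and commutativity lets them be ordered by degree.
  Coefficients in a domain are allowed because M[T] will be used.\<close>

lemma monic_irreducibleI:
  fixes f :: "'a::idom poly"
  assumes f: "lead_coeff f = 1" "degree f > 0"
    and no_factor: "\<And>g h. f = g * h \<Longrightarrow> lead_coeff g = 1 \<Longrightarrow> lead_coeff h = 1 \<Longrightarrow>
      0 < degree g \<Longrightarrow> degree g \<le> degree h \<Longrightarrow> False"
  shows "irreducible f"
proof (rule irreducibleI)
  show "f \<noteq> 0" using f by auto
  show "\<not> f dvd 1" using f by (auto simp: is_unit_poly_iff)
next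
  fix g h assume gh: "f = g * h"
  have *: "lead_coeff g * lead_coeff h = 1" using f gh by (simp add: lead_coeff_mult)
  show "g dvd 1 \<or> h dvd 1"
  proof (rule ccontr)
    assume nu: "\<not> (g dvd 1 \<or> h dvd 1)"
    have deg: "degree p > 0" if "\<not> p dvd 1" "lead_coeff p dvd 1" for p :: "'a poly"
      using that by (metis degree_0_id is_unit_const_poly_iff not_gr_zero)
    have dg: "degree g > 0" using nu * by (intro deg) (auto intro: dvdI[OF sym])
    have dh: "degree h > 0" using nu * by (intro deg) (auto intro: dvdI[OF sym] simp: mult.commute)
    \<comment> \<open>Each factor is scaled by the leading coefficient of the other: both become
      monic and the product stays \<open>f\<close>.\<close>
    define g' h' where "g' = smult (lead_coeff h) g" and "h' = smult (lead_coeff g) h"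
    have nz: "lead_coeff g \<noteq> 0" "lead_coeff h \<noteq> 0" using * by auto
    have f': "f = g' * h'" unfolding g'_def h'_def using gh * by (simp add: mult.commute)
    have "lead_coeff g' = 1" "lead_coeff h' = 1" "degree g' > 0" "degree h' > 0"
      unfolding g'_def h'_def using * nz dg dh by (simp_all add: mult.commute)
    then show False using no_factor[of g' h'] no_factor[of h' g'] f'
      by (metis mult.commute nat_le_linear)
  qed
qed

lemma monic_degree_1:
  fixes p :: "'a::comm_semiring_1 poly"
  assumes "lead_coeff p = 1" "degree p = 1"
  obtains c where "p = [:c, 1:]"
proof
  show "p = [:coeff p 0, 1:]"
    using assms by (intro poly_eqI) (auto simp: coeff_pCons coeff_eq_0 split: nat.split)
qed

lemma monic_degree_2:
  fixes p :: "'a::comm_semiring_1 poly"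
  assumes "lead_coeff p = 1" "degree p = 2"
  obtains c d where "p = [:c, d, 1:]"
proof
  show "p = [:coeff p 0, coeff p 1, 1:]"
    using assms
    by (intro poly_eqI) (auto simp: coeff_pCons coeff_eq_0 numeral_2_eq_2 split: nat.split)
qed

lemma degree_lead_coeff_binomial:
  fixes c :: "'a::comm_semiring_1"
  assumes "k > 0"
  shows "degree (monom 1 k + [:c:]) = k" "lead_coeff (monom 1 k + [:c:]) = 1"
proof -
  show "degree (monom 1 k + [:c:]) = k"
    using assms by (subst degree_add_eq_left) (auto simp: degree_monom_eq)
  then show "lead_coeff (monom 1 k + [:c:]) = 1"
    using assms by (auto simp: coeff_pCons split: nat.split)
qed

text \<open>A monic linear factor X + c would make c a square root of n.\<close>

lemma irreducible_quadratic_binomial: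
  fixes n :: "'a::idom"
  assumes "\<And>p. p\<^sup>2 \<noteq> n"
  shows "irreducible (monom 1 2 + [:- n:])"
proof (rule monic_irreducibleI)
  fix g h
  assume gh: "monom 1 2 + [:- n:] = g * h" "lead_coeff g = 1" "lead_coeff h = 1"
    "0 < degree g" "degree g \<le> degree h"
  have "degree g + degree h = degree (g * h)"
    using gh by (metis degree_mult_eq leading_coeff_0_iff zero_neq_one)
  then have "degree g + degree h = 2" by (simp add: degree_lead_coeff_binomial flip: gh(1))
  then have "degree g = 1" using gh(4,5) by linarith
  then obtain c where "g = [:c, 1:]" using monic_degree_1 gh by blast
  then have "poly (g * h) (- c) = 0" by simp
  then show False using assms[of c] by (simp add: poly_monom flip: gh(1))
qed (simp_all add: degree_lead_coeff_binomial coeff_eq_0)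

text \<open>The only possible quadratic factors are those of the Sophie Germain identity
  \<open>X\<^sup>4 + 4 d\<^sup>4 = (X\<^sup>2 + 2 d X + 2 d\<^sup>2) (X\<^sup>2 - 2 d X + 2 d\<^sup>2)\<close>, where \<open>n = \<plusminus> d\<^sup>2\<close>.\<close>

lemma irreducible_quartic_binomial:
  fixes n :: "'a::idom"
  assumes two: "(2::'a) \<noteq> 0"
    and i: "\<And>p. p\<^sup>2 \<noteq> - 4 * n\<^sup>2" and pos: "\<And>p. p\<^sup>2 \<noteq> 4 * n" and neg: "\<And>p. p\<^sup>2 \<noteq> - 4 * n"
  shows "irreducible (monom 1 4 + [:4 * n\<^sup>2:])"
proof (rule monic_irreducibleI)
  fix g h
  assume gh: "monom 1 4 + [:4 * n\<^sup>2:] = g * h" "lead_coeff g = 1" "lead_coeff h = 1"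
    "0 < degree g" "degree g \<le> degree h"
  have "degree g + degree h = degree (g * h)"
    using gh by (metis degree_mult_eq leading_coeff_0_iff zero_neq_one)
  then have deg: "degree g + degree h = 4" by (simp add: degree_lead_coeff_binomial flip: gh(1))
  then consider "degree g = 1" | "degree g = 2" "degree h = 2" using gh by linarith
  then show False
  proof cases
    case 1
    then obtain c where "g = [:c, 1:]" using monic_degree_1 gh by blast
    then have "poly (g * h) (- c) = 0" by simp
    then have "c ^ 4 + 4 * n\<^sup>2 = 0" by (simp add: poly_monom flip: gh(1))
    then have "(c\<^sup>2)\<^sup>2 = - 4 * n\<^sup>2" by (simp add: eq_neg_iff_add_eq_0)
    then show False using i by blast
  next
    case 2
    then obtain q p s r where "g = [:q, p, 1:]" "h = [:s, r, 1:]"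
      using monic_degree_2 gh by metis
    moreover have "monom 1 4 + [:4 * n\<^sup>2:] = [:4 * n\<^sup>2, 0, 0, 0, 1:]"
      by (simp add: monom_altdef numeral_eq_Suc)
    ultimately have eqs: "p + r = 0" "q + s + p * r = 0" "p * s + q * r = 0" "q * s = 4 * n\<^sup>2"
      using gh(1) by (auto simp: algebra_simps)
    then have r: "r = - p" by (metis add_eq_0_iff)
    \<comment> \<open>The coefficient of X splits into two cases: \<open>p = 0\<close> makes -4 n^2
      the square of q, while \<open>s = q\<close> gives q = 2 n or q = -2 n and makes 2 q the square
      of p.\<close>
    have "p * (s - q) = 0" using eqs(3) r by (simp add: algebra_simps)
    then consider "p = 0" | "s = q" by auto
    then show False
    proof cases
      case 1
      then have "s = - q" using eqs(2) by (simp add: add_eq_0_iff)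
      then have "q\<^sup>2 = - 4 * n\<^sup>2"
        using eqs(4) by (simp add: power2_eq_square) (metis minus_minus)
      then show False using i by blast
    next
      case 2
      have p: "p\<^sup>2 = 2 * q" using eqs(2) r 2 by (simp add: power2_eq_square)
      have "(q - 2 * n) * (q + 2 * n) = 0"
        using eqs(4) 2 by (simp add: algebra_simps power2_eq_square)
      then have "q = 2 * n \<or> q = - 2 * n" by (auto simp: eq_neg_iff_add_eq_0)
      then show False using p pos[of p] neg[of p] by auto
    qed
  qed
qed (simp_all add: degree_lead_coeff_binomial coeff_eq_0)

section \<open>Separability of binomials and their Hilbert specializations\<close>

text \<open>A multiple root is also a root of the derivative k X^(k-1), hence is 0, but the binomial
  takes the value c there.\<close>

lemma rsquarefree_binomial:
  fixes c :: "'a::idom"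
  assumes "c \<noteq> 0" "of_nat k \<noteq> (0::'a)"
  shows "rsquarefree (monom 1 k + [:c:])"
proof -
  let ?f = "monom 1 k + [:c:]"
  have k: "k > 0" using assms(2) by (cases k) auto
  have f: "?f \<noteq> 0" using degree_lead_coeff_binomial(1)[OF k, of c] k by force
  have "order x ?f = 0 \<or> order x ?f = 1" for x
  proof (rule ccontr)
    assume "\<not> (order x ?f = 0 \<or> order x ?f = 1)"
    then have "2 \<le> order x ?f" by linarith
    then have "[:- x, 1:] ^ 2 dvd ?f" by (rule order_divides[THEN iffD2, OF disjI2])
    then obtain g where g: "?f = [:- x, 1:] ^ 2 * g" by (auto elim: dvdE)
    then have "poly ?f x = 0" by simp
    moreover have "poly (pderiv ?f) x = 0" unfolding g power2_eq_square mult.assoc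
      by (simp add: pderiv_mult del: mult_pCons_left)
    ultimately have "x ^ k + c = 0" "of_nat k * x ^ (k - 1) = 0"
      by (simp_all add: poly_monom pderiv_add pderiv_monom)
    then show False using assms k by (auto simp: zero_power)
  qed
  then show ?thesis using f by (simp add: rsquarefree_def)
qed

lemma map_poly_binomial:
  assumes "f 0 = 0" "f 1 = 1" "k > 0"
  shows "map_poly f (monom 1 k + [:c:]) = monom 1 k + [:f c:]"
  using assms by (intro poly_eqI) (auto simp: coeff_map_poly coeff_pCons split: nat.split)

lemma hilbertian_binomial:
  fixes c :: "'a::field poly"
  assumes hilb: "hilbertian TYPE('a)" and c: "c \<noteq> 0" and k: "of_nat k \<noteq> (0::'a)"
    and irr: "irreducible (monom 1 k + [:c:])"
  shows "infinite {t. irreducible (monom 1 k + [:poly c t:])}"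
proof -
  have k0: "k > 0" using k by (cases k) auto
  \<comment> \<open>Nonvanishing of k is carried from M through M[T] and M(T) to the algebraic
    closure, where separability is tested.\<close>
  have "of_nat k \<noteq> (0 :: 'a poly)" using k by (simp add: of_nat_poly)
  then have "of_nat k \<noteq> (0 :: 'a poly fract)"
    by (metis Fract_of_nat_eq of_nat_fract to_fract_def to_fract_eq_0_iff)
  then have "of_nat k \<noteq> (0 :: 'a poly fract alg_closure)"
    by (metis to_ac_eq_0_iff to_ac_of_nat)
  then have "separable_in_X (monom 1 k + [:c:])"
    using c k0 unfolding separable_in_X_def
    by (subst map_poly_binomial) (auto intro!: rsquarefree_binomial)
  moreover have "degree (monom 1 k + [:c:]) > 0" using k0 by (simp add: degree_lead_coeff_binomial)
  ultimately have "infinite {t. irreducible (specialize (monom 1 k + [:c:]) t)}"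
    using hilb irr unfolding hilbertian_def by blast
  moreover have "specialize (monom 1 k + [:c:]) t = monom 1 k + [:poly c t:]" for t
    unfolding specialize_def using k0 by (subst map_poly_binomial) auto
  ultimately show ?thesis by simp
qed

section \<open>Values that are neither squares nor negatives of squares\<close>

lemma not_irreducible_mult:
  fixes g h :: "'a::field poly"
  assumes "degree g > 0" "degree h > 0"
  shows "\<not> irreducible (g * h)"
proof
  assume "irreducible (g * h)"
  then have "is_unit g \<or> is_unit h" by (rule irreducibleD) simp
  then show False using assms by (auto simp: is_unit_poly_iff)
qed

text \<open>A single polynomial controls both signs at once: over a field without a square root of
  \<open>-1\<close>, the polynomial \<open>X\<^sup>4 + 4 n\<^sup>2\<close> is irreducible precisely if neither \<open>n\<close> nor \<open>-n\<close> is a square.\<close>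

lemma hilbertian_nonsquare_values:
  fixes N :: "'a::field poly"
  assumes hilb: "hilbertian TYPE('a)" and two: "(2::'a) \<noteq> 0"
    and pos: "\<And>w. w\<^sup>2 \<noteq> N" and neg: "\<And>w. w\<^sup>2 \<noteq> - N"
  shows "infinite {t. \<forall>d. poly N t \<noteq> d\<^sup>2 \<and> poly N t \<noteq> - d\<^sup>2}"
proof -
  have N: "N \<noteq> 0" using pos[of 0] by auto
  have four: "(4::'a) \<noteq> 0" using two by (metis mult_eq_0_iff numeral_Bit0 mult_2)
  show ?thesis
  proof (cases "\<exists>i::'a. i\<^sup>2 = - 1")
    case True
    then obtain i :: 'a where i: "i\<^sup>2 = - 1" by blast
    \<comment> \<open>With -1 a square, negatives of squares are squares, so the quadratic X^2 - N
      is enough.\<close>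
    have "infinite {t. irreducible (monom 1 2 + [:poly (- N) t:])}"
      using hilb N two irreducible_quadratic_binomial[of N] pos
      by (intro hilbertian_binomial) auto
    moreover have "poly N t \<noteq> d\<^sup>2" if irr: "irreducible (monom 1 2 + [:poly (- N) t:])" for t d
    proof
      assume "poly N t = d\<^sup>2"
      then have "monom 1 2 + [:poly (- N) t:] = [:- d, 1:] * [:d, 1:]"
        by (simp add: monom_altdef power2_eq_square)
      then show False using irr by (metis not_irreducible_mult degree_pCons_eq_if one_pCons
            one_neq_zero pCons_eq_0_iff zero_less_Suc)
    qed
    moreover have "- d\<^sup>2 = (i * d)\<^sup>2" for d using i by (simp add: power_mult_distrib)
    ultimately show ?thesis
      by (elim infinite_super[rotated]) auto
  next
    case False
    have "irreducible (monom 1 4 + [:4 * N\<^sup>2:])"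
    proof (rule irreducible_quartic_binomial)
      show "(2 :: 'a poly) \<noteq> 0" using two by (simp add: numeral_poly)
    next
      fix p
      show "p\<^sup>2 \<noteq> - 4 * N\<^sup>2"
      proof
        assume "p\<^sup>2 = - 4 * N\<^sup>2"
        then have "p\<^sup>2 = smult (- 4) (N\<^sup>2)" by (simp add: numeral_poly)
        then have "lead_coeff (p\<^sup>2) = lead_coeff (smult (- 4) (N\<^sup>2))" by simp
        then have "(lead_coeff p)\<^sup>2 = - 4 * (lead_coeff N)\<^sup>2"
          by (simp only: lead_coeff_power lead_coeff_smult)
        \<comment> \<open>Leading coefficients turn a square root of -4 N^2 in M[T] into a square
          root of -1 in M.\<close>
        then have "(lead_coeff p / (2 * lead_coeff N))\<^sup>2 = - 1"
          using N two four by (simp add: power_divide power_mult_distrib field_simps)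
        then show False using False by blast
      qed
      show "p\<^sup>2 \<noteq> 4 * N"
      proof
        assume "p\<^sup>2 = 4 * N"
        then have "(smult (1 / 2) p)\<^sup>2 = N"
          using four by (simp add: smult_power numeral_poly power_divide)
        then show False using pos by blast
      qed
      show "p\<^sup>2 \<noteq> - 4 * N"
      proof
        assume "p\<^sup>2 = - 4 * N"
        then have "(smult (1 / 2) p)\<^sup>2 = - N"
          using four by (simp add: smult_power numeral_poly power_divide)
        then show False using neg by blast
      qed
    qed
    moreover have "4 * N\<^sup>2 \<noteq> 0" using N four by (simp add: numeral_poly)
    ultimately have inf: "infinite {t. irreducible (monom 1 4 + [:poly (4 * N\<^sup>2) t:])}"
      using hilb four by (intro hilbertian_binomial) auto
    \<comment> \<open>This treats both signs, as N(t) = d^2 and N(t) = -d^2 each give N(t)^2 = d^4;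
      the Sophie Germain factors then contradict irreducibility.\<close>
    have *: "(poly N t)\<^sup>2 \<noteq> d ^ 4" if irr: "irreducible (monom 1 4 + [:poly (4 * N\<^sup>2) t:])" for t d
    proof
      assume eq: "(poly N t)\<^sup>2 = d ^ 4"
      have "monom 1 4 + [:4 * d ^ 4:] = [:2 * d\<^sup>2, 2 * d, 1:] * [:2 * d\<^sup>2, - 2 * d, 1:]"
        by (simp add: monom_altdef numeral_eq_Suc)
      then show False using irr eq not_irreducible_mult[of "[:2 * d\<^sup>2, 2 * d, 1:]" "[:2 * d\<^sup>2, - 2 * d, 1:]"]
        by (simp add: poly_monom)
    qed
    have "poly N t \<noteq> d\<^sup>2 \<and> poly N t \<noteq> - d\<^sup>2"
      if "irreducible (monom 1 4 + [:poly (4 * N\<^sup>2) t:])" for t d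
      using *[OF that, of d] by (auto simp flip: power_mult)
    then show ?thesis using inf by (elim infinite_super[rotated]) auto
  qed
qed

text \<open>A square root would be linear, x + y T, and (2 x y)^2 = 4 x^2 y^2 would force the
  discriminant a^2 - 4 b to vanish. The values 1 and -1 of e cover N and -N.\<close>

lemma quadratic_not_square:
  fixes a b e :: "'a::field"
  assumes "a\<^sup>2 \<noteq> 4 * b" "e\<^sup>2 = 1"
  shows "w\<^sup>2 \<noteq> smult e [:b, - a, 1:]"
proof
  assume w: "w\<^sup>2 = smult e [:b, - a, 1:]"
  have e: "e \<noteq> 0" using assms(2) by auto
  then have deg: "degree (w * w) = 2" using w by (simp flip: power2_eq_square)
  then have "w \<noteq> 0" by auto
  then have "degree w = 1" using deg by (simp add: degree_mult_eq)
  define x y where "x = coeff w 0" and "y = coeff w 1"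
  have "w = [:x, y:]" using \<open>degree w = 1\<close>
    by (intro poly_eqI) (auto simp: x_def y_def coeff_pCons coeff_eq_0 split: nat.split)
  then have xy: "x * x = e * b" "x * y + x * y = - (e * a)" "y * y = e"
    using w by (auto simp: power2_eq_square algebra_simps)
  have "e\<^sup>2 * a\<^sup>2 = (x * y + x * y)\<^sup>2" unfolding xy(2) by (simp add: power_mult_distrib)
  also have "\<dots> = 4 * ((x * x) * (y * y))" by (simp add: power2_eq_square algebra_simps)
  also have "\<dots> = e\<^sup>2 * (4 * b)" unfolding xy by (simp add: power2_eq_square)
  finally show False using assms by simp
qed

section \<open>Field operations inside a splitting field\<close>

lemma ring_of_type_algebra_simps:
  "carrier ring_of_type_algebra = UNIV" "\<zero>\<^bsub>ring_of_type_algebra\<^esub> = (0::'a::field)"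
  "x \<oplus>\<^bsub>ring_of_type_algebra\<^esub> y = x + (y::'a)" "x \<otimes>\<^bsub>ring_of_type_algebra\<^esub> y = x * y"
  "\<one>\<^bsub>ring_of_type_algebra\<^esub> = (1::'a)"
  by (simp_all add: ring_of_type_algebra_def)

lemma a_inv_ring_of_type_algebra: "\<ominus>\<^bsub>ring_of_type_algebra\<^esub> x = - (x::'a::field)"
proof -
  interpret ring "ring_of_type_algebra :: 'a ring" by (rule ring_from_type_algebra)
  show ?thesis by (rule minus_equality) (simp_all add: ring_of_type_algebra_simps)
qed

lemma m_inv_ring_of_type_algebra:
  assumes "x \<noteq> 0"
  shows "inv\<^bsub>ring_of_type_algebra\<^esub> x = inverse (x::'a::field)"
proof -
  interpret cring "ring_of_type_algebra :: 'a ring" by (rule cring_from_type_algebra)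
  show ?thesis using assms by (intro comm_inv_char) (simp_all add: ring_of_type_algebra_simps)
qed

lemma splitting_field_to_ac: "to_ac c \<in> splitting_field p"
  unfolding splitting_field_def by (rule generate_field.incl) simp

lemma splitting_field_root: "poly (map_poly to_ac p) x = 0 \<Longrightarrow> x \<in> splitting_field p"
  unfolding splitting_field_def by (rule generate_field.incl) simp

lemma splitting_field_add:
  "x \<in> splitting_field p \<Longrightarrow> y \<in> splitting_field p \<Longrightarrow> x + y \<in> splitting_field p"
  unfolding splitting_field_def
  using generate_field.eng_add[of x ring_of_type_algebra _ y] by (simp add: ring_of_type_algebra_simps)

lemma splitting_field_mult:
  "x \<in> splitting_field p \<Longrightarrow> y \<in> splitting_field p \<Longrightarrow> x * y \<in> splitting_field p"
  unfolding splitting_field_def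
  using generate_field.eng_mult[of x ring_of_type_algebra _ y] by (simp add: ring_of_type_algebra_simps)

lemma splitting_field_uminus: "x \<in> splitting_field p \<Longrightarrow> - x \<in> splitting_field p"
  unfolding splitting_field_def
  using generate_field.a_inv[of x ring_of_type_algebra] by (simp add: a_inv_ring_of_type_algebra)

lemma splitting_field_inverse: "x \<in> splitting_field p \<Longrightarrow> inverse x \<in> splitting_field p"
  unfolding splitting_field_def
  using generate_field.m_inv[of x ring_of_type_algebra]
  \<comment> \<open>\<open>generate_field\<close> inverts only nonzero elements; for
    \<open>x = 0\<close> the convention \<open>inverse 0 = 0\<close> applies.\<close>
  by (cases "x = 0") (simp_all add: m_inv_ring_of_type_algebra ring_of_type_algebra_simps)

lemma splitting_field_diff:
  "x \<in> splitting_field p \<Longrightarrow> y \<in> splitting_field p \<Longrightarrow> x - y \<in> splitting_field p"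
  using splitting_field_add[OF _ splitting_field_uminus] by (metis diff_conv_add_uminus)

lemma splitting_field_divide:
  "x \<in> splitting_field p \<Longrightarrow> y \<in> splitting_field p \<Longrightarrow> x / y \<in> splitting_field p"
  by (simp add: divide_inverse splitting_field_mult splitting_field_inverse)

lemma splitting_field_power: "x \<in> splitting_field p \<Longrightarrow> x ^ n \<in> splitting_field p"
  using splitting_field_to_ac[of 1 p] by (induction n) (simp_all add: splitting_field_mult)

lemmas splitting_field_intros = splitting_field_to_ac splitting_field_add splitting_field_mult
  splitting_field_uminus splitting_field_diff splitting_field_divide splitting_field_power

text \<open>Reduces an inclusion to the roots: the generated field is the least subfield containing
  its generators, and constants lie in every splitting field.\<close>

lemma splitting_field_subset:
  assumes "\<And>x. poly (map_poly to_ac p) x = 0 \<Longrightarrow> x \<in> splitting_field q"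
  shows "splitting_field p \<subseteq> splitting_field q"
proof -
  interpret field "ring_of_type_algebra :: 'a alg_closure ring" by (rule field_from_type_algebra)
  have "subfield (splitting_field q) ring_of_type_algebra"
    unfolding splitting_field_def
    by (rule generate_field_is_subfield) (simp add: ring_of_type_algebra_simps)
  then show ?thesis
    unfolding splitting_field_def[of p]
    using assms splitting_field_to_ac
    by (intro generate_field_min_subfield1) (auto simp: ring_of_type_algebra_simps)
qed

section \<open>Roots of biquadratic polynomials and the transformation by t\<close>

lemma poly_biquadratic:
  "poly (map_poly to_ac (biquadratic a b)) x = x ^ 4 + to_ac a * x\<^sup>2 + to_ac b"
proof -
  have "biquadratic a b = [:b, 0, a, 0, 1:]"
    by (simp add: biquadratic_def monom_altdef numeral_eq_Suc)
  then have "map_poly to_ac (biquadratic a b) = [:to_ac b, 0, to_ac a, 0, 1:]"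
    by (simp add: map_poly_pCons)
  then show ?thesis by (simp add: algebra_simps numeral_eq_Suc)
qed

lemma biquadratic_roots:
  assumes "to_ac a = - (\<alpha>\<^sup>2 + \<beta>\<^sup>2)" "to_ac b = \<alpha>\<^sup>2 * \<beta>\<^sup>2"
  shows "poly (map_poly to_ac (biquadratic a b)) x = 0 \<longleftrightarrow> x \<in> {\<alpha>, - \<alpha>, \<beta>, - \<beta>}"
proof -
  have "poly (map_poly to_ac (biquadratic a b)) x = (x\<^sup>2 - \<alpha>\<^sup>2) * (x\<^sup>2 - \<beta>\<^sup>2)"
    unfolding poly_biquadratic assms by (simp add: algebra_simps power4_eq_xxxx power2_eq_square)
  then show ?thesis by (auto simp: power2_eq_iff)
qed

lemma biquadratic_splits:
  obtains \<alpha> \<beta> where "to_ac a = - (\<alpha>\<^sup>2 + \<beta>\<^sup>2)" "to_ac b = \<alpha>\<^sup>2 * \<beta>\<^sup>2"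
proof -
  have "map_poly to_ac (biquadratic a b) = [:to_ac b, 0, to_ac a, 0, 1:]"
    by (simp add: biquadratic_def monom_altdef numeral_eq_Suc map_poly_pCons)
  then have "degree (map_poly to_ac (biquadratic a b)) > 0" by simp
  then obtain \<alpha> where "poly (map_poly to_ac (biquadratic a b)) \<alpha> = 0"
    using alg_closed_imp_poly_has_root by blast
  then have \<alpha>: "\<alpha> ^ 4 + to_ac a * \<alpha>\<^sup>2 + to_ac b = 0" by (simp add: poly_biquadratic)
  \<comment> \<open>Vieta for Y^2 + a Y + b, whose roots are the squares of \<alpha> and \<beta> and
    sum to -a.\<close>
  obtain \<beta> where \<beta>: "\<beta>\<^sup>2 = - to_ac a - \<alpha>\<^sup>2" using nth_root_exists[of 2] by auto
  have "to_ac a = - (\<alpha>\<^sup>2 + \<beta>\<^sup>2)" using \<beta> by simp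
  moreover have "to_ac b = \<alpha>\<^sup>2 * \<beta>\<^sup>2"
    using \<alpha> unfolding \<beta> by (simp add: algebra_simps power4_eq_xxxx power2_eq_square add_eq_0_iff2)
  ultimately show ?thesis by (rule that)
qed

text \<open>By hypothesis \<open>N\<close> the factors \<open>t + \<alpha>\<^sup>2\<close> and \<open>t + \<beta>\<^sup>2\<close> are nonzero. Up to the factor of hypothesis
  \<open>K\<close>, the squares of \<open>\<alpha> (t + \<alpha>\<^sup>2)\<close> and \<open>\<beta> (t + \<beta>\<^sup>2)\<close> have the same difference as \<open>\<alpha>\<^sup>2\<close> and \<open>\<beta>\<^sup>2\<close>.\<close>

lemma splitting_field_transform:
  fixes a b t :: "'a::field"
  assumes two: "(2::'a) \<noteq> 0"
    and N: "t\<^sup>2 - a * t + b \<noteq> 0" and K: "t\<^sup>2 - 2 * a * t + a\<^sup>2 - b \<noteq> 0"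
  shows "splitting_field (biquadratic a b) =
    splitting_field (biquadratic (a * t\<^sup>2 - 2 * (a\<^sup>2 - 2 * b) * t + a ^ 3 - 3 * a * b)
      (b * (t\<^sup>2 - a * t + b)\<^sup>2))" (is "splitting_field ?p = splitting_field ?q")
proof -
  obtain \<alpha> \<beta> where ab: "to_ac a = - (\<alpha>\<^sup>2 + \<beta>\<^sup>2)" "to_ac b = \<alpha>\<^sup>2 * \<beta>\<^sup>2"
    by (rule biquadratic_splits)
  define \<gamma> \<delta> where gd: "\<gamma> = \<alpha> * (to_ac t + \<alpha>\<^sup>2)" "\<delta> = \<beta> * (to_ac t + \<beta>\<^sup>2)"
  have roots_p: "poly (map_poly to_ac ?p) x = 0 \<longleftrightarrow> x \<in> {\<alpha>, - \<alpha>, \<beta>, - \<beta>}" for x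
    using ab by (rule biquadratic_roots)
  have roots_q: "poly (map_poly to_ac ?q) x = 0 \<longleftrightarrow> x \<in> {\<gamma>, - \<gamma>, \<delta>, - \<delta>}" for x
  proof (rule biquadratic_roots)
    \<comment> \<open>The new coefficient collects the power sums -a, a^2 - 2 b and -a^3 + 3 a b of
      \<alpha>^2 and \<beta>^2.\<close>
    show "to_ac (a * t\<^sup>2 - 2 * (a\<^sup>2 - 2 * b) * t + a ^ 3 - 3 * a * b) = - (\<gamma>\<^sup>2 + \<delta>\<^sup>2)"
      unfolding gd by (simp add: ab eval_nat_numeral algebra_simps)
    show "to_ac (b * (t\<^sup>2 - a * t + b)\<^sup>2) = \<gamma>\<^sup>2 * \<delta>\<^sup>2"
      unfolding gd by (simp add: ab eval_nat_numeral algebra_simps)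
  qed
  have "\<alpha> \<in> splitting_field ?p" "\<beta> \<in> splitting_field ?p"
    by (rule splitting_field_root, unfold roots_p, simp)+
  then have "\<gamma> \<in> splitting_field ?p" "\<delta> \<in> splitting_field ?p"
    unfolding gd by (auto intro!: splitting_field_intros)
  then have qp: "splitting_field ?q \<subseteq> splitting_field ?p"
    by (intro splitting_field_subset, unfold roots_q) (auto intro: splitting_field_uminus)
  have g: "\<gamma> \<in> splitting_field ?q" "\<delta> \<in> splitting_field ?q"
    by (rule splitting_field_root, unfold roots_q, simp)+
  have "to_ac (t\<^sup>2 - 2 * a * t + a\<^sup>2 - b) * (\<alpha>\<^sup>2 - \<beta>\<^sup>2) = \<gamma>\<^sup>2 - \<delta>\<^sup>2"
    unfolding gd by (simp add: ab eval_nat_numeral algebra_simps)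
  then have diff: "\<alpha>\<^sup>2 - \<beta>\<^sup>2 = (\<gamma>\<^sup>2 - \<delta>\<^sup>2) / to_ac (t\<^sup>2 - 2 * a * t + a\<^sup>2 - b)"
    using K by (metis nonzero_mult_div_cancel_left to_ac_eq_0_iff)
  have d: "\<alpha>\<^sup>2 - \<beta>\<^sup>2 \<in> splitting_field ?q"
    unfolding diff using g by (intro splitting_field_intros)
  have two': "(2 :: 'a alg_closure) \<noteq> 0"
    using two by (metis to_ac_eq_0_iff to_ac_numeral)
  \<comment> \<open>Both squares are recovered from their sum -a and their difference, which
    requires division by 2.\<close>
  have "\<alpha>\<^sup>2 = (\<alpha>\<^sup>2 - \<beta>\<^sup>2 - to_ac a) / to_ac 2" "\<beta>\<^sup>2 = (- (\<alpha>\<^sup>2 - \<beta>\<^sup>2) - to_ac a) / to_ac 2"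
    using two' by (simp_all add: ab field_simps)
  then have sq: "\<alpha>\<^sup>2 \<in> splitting_field ?q" "\<beta>\<^sup>2 \<in> splitting_field ?q"
    using d by (metis splitting_field_intros(1,4,5,6))+
  have "(to_ac t + \<alpha>\<^sup>2) * (to_ac t + \<beta>\<^sup>2) = to_ac (t\<^sup>2 - a * t + b)"
    by (simp add: ab eval_nat_numeral algebra_simps)
  then have "to_ac t + \<alpha>\<^sup>2 \<noteq> 0" "to_ac t + \<beta>\<^sup>2 \<noteq> 0" using N
    by (metis mult_zero_left mult_zero_right to_ac_eq_0_iff)+
  then have "\<alpha> = \<gamma> / (to_ac t + \<alpha>\<^sup>2)" "\<beta> = \<delta> / (to_ac t + \<beta>\<^sup>2)" by (simp_all add: gd)
  then have "\<alpha> \<in> splitting_field ?q" "\<beta> \<in> splitting_field ?q"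
    using g sq by (metis splitting_field_intros(1,2,6))+
  then have "splitting_field ?p \<subseteq> splitting_field ?q"
    by (intro splitting_field_subset, unfold roots_p) (auto intro: splitting_field_uminus)
  then show ?thesis using qp by blast
qed

section \<open>Infinitely many transforms with the same splitting field\<close>

theorem theorem4p16:
  fixes \<iota> :: "'k::field \<Rightarrow> 'm::field" and a b :: 'm
  assumes "CHAR('k) \<noteq> 2"
    and "\<iota> \<in> ring_hom ring_of_type_algebra ring_of_type_algebra"
    and "hilbertian TYPE('m)"
    and "biquadratic_disc a b \<noteq> 0"
  shows "infinite {(a', b').
           \<not> (\<exists>c. b' / b = c ^ 4) \<and>
           splitting_field (biquadratic a b) = splitting_field (biquadratic a' b')}"
    (is "infinite ?S")
proof -
  have b: "b \<noteq> 0" and disc: "a\<^sup>2 \<noteq> 4 * b" and "(16::'m) \<noteq> 0"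
    using assms(4) by (auto simp: biquadratic_disc_def)
  \<comment> \<open>Nonvanishing of the factor 16 in the discriminant yields 2 \<noteq> 0 in
    M.\<close>
  moreover have "(16::'m) = 2 ^ 4" by simp
  ultimately have two: "(2::'m) \<noteq> 0" by (metis zero_neq_numeral power_zero_numeral)
  define N where "N = [:b, - a, 1:]"
  define K where "K = [:a\<^sup>2 - b, - 2 * a, 1:]"
  define F where "F t = (a * t\<^sup>2 - 2 * (a\<^sup>2 - 2 * b) * t + a ^ 3 - 3 * a * b,
    b * (t\<^sup>2 - a * t + b)\<^sup>2)" for t
  \<comment> \<open>Admissible parameters: the Hilbert set for N without the finitely many roots of
    K.\<close>
  define T where "T = {t. \<forall>d. poly N t \<noteq> d\<^sup>2 \<and> poly N t \<noteq> - d\<^sup>2} - {t. poly K t = 0}"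
  have N: "poly N t = t\<^sup>2 - a * t + b" for t
    by (simp add: N_def power2_eq_square algebra_simps)
  have K: "poly K t = t\<^sup>2 - 2 * a * t + a\<^sup>2 - b" for t
    by (simp add: K_def power2_eq_square algebra_simps)
  have "infinite {t. \<forall>d. poly N t \<noteq> d\<^sup>2 \<and> poly N t \<noteq> - d\<^sup>2}"
    using quadratic_not_square[OF disc, of 1] quadratic_not_square[OF disc, of "- 1"]
    by (intro hilbertian_nonsquare_values assms(3) two) (simp_all add: N_def)
  moreover have "finite {t. poly K t = 0}"
    by (rule poly_roots_finite) (simp add: K_def)
  ultimately have "infinite T" unfolding T_def by (rule Diff_infinite_finite[rotated])
  \<comment> \<open>Fibres of \<open>F\<close> are finite because its second coordinate b N(t)^2 is
    a polynomial of degree 4 in t.\<close>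
  moreover have "finite {t \<in> T. F t = y}" for y
  proof (rule finite_subset)
    define P where "P = smult b (N\<^sup>2) - [:snd y:]"
    have "degree (smult b (N\<^sup>2)) = 4" using b by (simp add: N_def degree_power_eq)
    then have "P \<noteq> 0" unfolding P_def by (metis degree_pCons_0 eq_iff_diff_eq_0 zero_neq_numeral)
    then show "finite {t. poly P t = 0}" by (rule poly_roots_finite)
    show "{t \<in> T. F t = y} \<subseteq> {t. poly P t = 0}" by (auto simp: P_def F_def N)
  qed
  ultimately have "infinite (F ` T)"
    using pigeonhole_infinite[of T F] by auto
  moreover have "F ` T \<subseteq> ?S"
  proof (rule image_subsetI)
    fix t
    assume t: "t \<in> T"
    \<comment> \<open>The instance d = 0 of the nonsquare condition.\<close>
    have "poly N t \<noteq> 0" using t unfolding T_def by (auto dest: spec[of _ 0])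
    moreover have "poly K t \<noteq> 0" using t unfolding T_def by simp
    ultimately have "splitting_field (biquadratic a b) =
        splitting_field (biquadratic (fst (F t)) (snd (F t)))"
      using splitting_field_transform[OF two, of t a b] by (simp add: F_def N K)
    moreover have "snd (F t) / b \<noteq> c ^ 4" for c
    proof
      assume "snd (F t) / b = c ^ 4"
      \<comment> \<open>Here b'/b = N(t)^2, so a fourth power c^4 would give N(t) = c^2 or N(t) =
        -c^2.\<close>
      then have "(poly N t)\<^sup>2 = (c\<^sup>2)\<^sup>2" using b by (simp add: F_def N)
      then have "poly N t = c\<^sup>2 \<or> poly N t = - c\<^sup>2" by (simp only: power2_eq_iff)
      then show False using t unfolding T_def by blast
    qed
    ultimately show "F t \<in> ?S" by (auto simp: case_prod_beta)
  qed
  ultimately show ?thesis by (rule infinite_super[rotated])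
qed

end
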